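(* Let $\mathcal{C}$ and $\mathcal{D}$ be categories and let $(F,G;\eta,\epsilon)$ be an adjoint pair, where $F\colon\mathcal{C}\to\mathcal{D}$ is left adjoint to $G\colon\mathcal{D}\to\mathcal{C}$, with unit $\eta\colon \mathrm{Id}_\mathcal{C}\to GF$ and counit $\epsilon\colon FG\to\mathrm{Id}_\mathcal{D}$. Let $M=(GF,\eta,G\epsilon F)$ be the monad on $\mathcal{C}$ defined by this adjoint pair, and let $K\colon\mathcal{D}\to M\text{-}\mathrm{Mod}_\mathcal{C}$ be the associated comparison functor. Assume that $\mathcal{D}$ is idempotent complete. Then the functor $G$ is separable if and only if $M$ is a separable monad and $K$ is an equivalence of categories.
   Context: Separable functor: a functor $G\colon\mathcal{D}\to\mathcal{C}$ is separable if the natural transformation of bifunctors $\mathrm{Hom}_\mathcal{D}(-,-)\to\mathrm{Hom}_\mathcal{C}(G-,G-)$, $f\mapsto G(f)$, admits a retraction, i.e. there are maps $H_{X,Y}\colon\mathrm{Hom}_\mathcal{C}(G(X),G(Y))\to\mathrm{Hom}_\mathcal{D}(X,Y)$, natural in both $X$ and $Y$, with $H_{X,Y}(G(f))=f$ for every $f\colon X\to Y$. Monad: a triple $(M,\eta,\mu)$ with $M\colon\mathcal{C}\to\mathcal{C}$ an endofunctor and natural transformations $\eta\colon\mathrm{Id}_\mathcal{C}\to M$, $\mu\colon M^2\to M$ satisfying $\mu\circ M\mu=\mu\circ\mu M$ and $\mu\circ M\eta=\mathrm{Id}_M=\mu\circ\eta M$. Separable monad: a monad $(M,\eta,\mu)$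 is separable if there is a natural transformation $\sigma\colon M\to M^2$ with $\mu\circ\sigma=\mathrm{Id}_M$ and $M\mu\circ\sigma M=\sigma\circ\mu=\mu M\circ M\sigma$. Modules: an $M$-module is a pair $(X,\lambda)$ with $X$ an object of $\mathcal{C}$ and $\lambda\colon M(X)\to X$ satisfying $\lambda\circ M(\lambda)=\lambda\circ\mu_X$ and $\lambda\circ\eta_X=\mathrm{Id}_X$. A morphism $(X,\lambda)\to(X',\lambda')$ is a morphism $f\colon X\to X'$ with $f\circ\lambda=\lambda'\circ M(f)$. These form the category $M\text{-}\mathrm{Mod}_\mathcal{C}$. Comparison functor: $K(D)=(G(D),G(\epsilon_D))$ on objects and $K(f)=G(f)$ on morphisms. Idempotent complete: every idempotent $e\colon X\to X$ splits, i.e. there are $u\colon X\to Y$ and $v\colon Y\to X$ with $e=v\circ u$ and $u\circ v=\mathrm{Id}_Y$. *)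

theory Defs
  imports Main
begin

text \<open>Hom-sets are carved out of a set of arrows by domain and codomain, so that they are
  pairwise disjoint. All fields are unconstrained outside the carriers \<open>Obj\<close> and \<open>Arr\<close>.\<close>

record ('o, 'm) category =
  Obj :: "'o set"
  Arr :: "'m set"
  Dom :: "'m \<Rightarrow> 'o"
  Cod :: "'m \<Rightarrow> 'o"
  Ide :: "'o \<Rightarrow> 'm"
  Comp :: "'m \<Rightarrow> 'm \<Rightarrow> 'm"  (infixr "\<cdot>\<index>" 70)

definition hom :: "('o, 'm) category \<Rightarrow> 'o \<Rightarrow> 'o \<Rightarrow> 'm set" where
  "hom C X Y = {f \<in> Arr C. Dom C f = X \<and> Cod C f = Y}"

locale category =
  fixes C :: "('o, 'm) category" (structure)
  assumes dom_obj: "f \<in> Arr C \<Longrightarrow> Dom C f \<in> Obj C"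
    and cod_obj: "f \<in> Arr C \<Longrightarrow> Cod C f \<in> Obj C"
    and ide_hom: "X \<in> Obj C \<Longrightarrow> Ide C X \<in> hom C X X"
    and comp_hom: "\<lbrakk>f \<in> hom C X Y; g \<in> hom C Y Z\<rbrakk> \<Longrightarrow> g \<cdot> f \<in> hom C X Z"
    and comp_ide_left: "f \<in> hom C X Y \<Longrightarrow> Ide C Y \<cdot> f = f"
    and comp_ide_right: "f \<in> hom C X Y \<Longrightarrow> f \<cdot> Ide C X = f"
    and comp_assoc: "\<lbrakk>f \<in> hom C W X; g \<in> hom C X Y; h \<in> hom C Y Z\<rbrakk>
      \<Longrightarrow> (h \<cdot> g) \<cdot> f = h \<cdot> (g \<cdot> f)"

definition is_iso :: "('o, 'm) category \<Rightarrow> 'o \<Rightarrow> 'o \<Rightarrow> 'm \<Rightarrow> bool" where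
  "is_iso C X Y f \<longleftrightarrow> f \<in> hom C X Y \<and>
     (\<exists>g \<in> hom C Y X. g \<cdot>\<^bsub>C\<^esub> f = Ide C X \<and> f \<cdot>\<^bsub>C\<^esub> g = Ide C Y)"

definition idempotent_complete :: "('o, 'm) category \<Rightarrow> bool" where
  "idempotent_complete C \<longleftrightarrow>
     (\<forall>X \<in> Obj C. \<forall>e \<in> hom C X X. e \<cdot>\<^bsub>C\<^esub> e = e \<longrightarrow>
       (\<exists>Y \<in> Obj C. \<exists>u \<in> hom C X Y. \<exists>v \<in> hom C Y X.
          e = v \<cdot>\<^bsub>C\<^esub> u \<and> u \<cdot>\<^bsub>C\<^esub> v = Ide C Y))"

record ('o1, 'm1, 'o2, 'm2) cat_functor =
  fobj :: "'o1 \<Rightarrow> 'o2"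
  farr :: "'m1 \<Rightarrow> 'm2"

locale cat_functor = A: category A + B: category B
  for A :: "('o1, 'm1) category" and B :: "('o2, 'm2) category" +
  fixes F :: "('o1, 'm1, 'o2, 'm2) cat_functor"
  assumes map_obj: "X \<in> Obj A \<Longrightarrow> fobj F X \<in> Obj B"
    and map_hom: "f \<in> hom A X Y \<Longrightarrow> farr F f \<in> hom B (fobj F X) (fobj F Y)"
    and map_ide: "X \<in> Obj A \<Longrightarrow> farr F (Ide A X) = Ide B (fobj F X)"
    and map_comp: "\<lbrakk>f \<in> hom A X Y; g \<in> hom A Y Z\<rbrakk>
      \<Longrightarrow> farr F (g \<cdot>\<^bsub>A\<^esub> f) = farr F g \<cdot>\<^bsub>B\<^esub> farr F f"

definition id_functor :: "('o, 'm, 'o, 'm) cat_functor" where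
  "id_functor = \<lparr>fobj = \<lambda>X. X, farr = \<lambda>f. f\<rparr>"

definition comp_functor ::
  "('o2, 'm2, 'o3, 'm3) cat_functor \<Rightarrow> ('o1, 'm1, 'o2, 'm2) cat_functor
     \<Rightarrow> ('o1, 'm1, 'o3, 'm3) cat_functor"  (infixr "\<odot>" 75) where
  "G \<odot> F = \<lparr>fobj = \<lambda>X. fobj G (fobj F X), farr = \<lambda>f. farr G (farr F f)\<rparr>"

text \<open>A natural transformation is its family of components. Components at elements outside
  \<open>Obj A\<close> are irrelevant, so equality of natural transformations is always stated
  componentwise on objects.\<close>

locale nat_trans = F: cat_functor A B F + G: cat_functor A B G
  for A :: "('o1, 'm1) category" and B :: "('o2, 'm2) category"
    and F G :: "('o1, 'm1, 'o2, 'm2) cat_functor" +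
  fixes \<tau> :: "'o1 \<Rightarrow> 'm2"
  assumes component: "X \<in> Obj A \<Longrightarrow> \<tau> X \<in> hom B (fobj F X) (fobj G X)"
    and naturality: "f \<in> hom A X Y \<Longrightarrow> farr G f \<cdot>\<^bsub>B\<^esub> \<tau> X = \<tau> Y \<cdot>\<^bsub>B\<^esub> farr F f"

definition nat_iso ::
  "('o1, 'm1) category \<Rightarrow> ('o2, 'm2) category \<Rightarrow> ('o1, 'm1, 'o2, 'm2) cat_functor
     \<Rightarrow> ('o1, 'm1, 'o2, 'm2) cat_functor \<Rightarrow> ('o1 \<Rightarrow> 'm2) \<Rightarrow> bool" where
  "nat_iso A B F G \<tau> \<longleftrightarrow>
     nat_trans A B F G \<tau> \<and> (\<forall>X \<in> Obj A. is_iso B (fobj F X) (fobj G X) (\<tau> X))"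

definition equivalence_of_categories ::
  "('o1, 'm1) category \<Rightarrow> ('o2, 'm2) category \<Rightarrow> ('o1, 'm1, 'o2, 'm2) cat_functor \<Rightarrow> bool" where
  "equivalence_of_categories A B F \<longleftrightarrow> cat_functor A B F \<and>
     (\<exists>L \<alpha> \<beta>. cat_functor B A L \<and>
        nat_iso A A id_functor (L \<odot> F) \<alpha> \<and> nat_iso B B (F \<odot> L) id_functor \<beta>)"

text \<open>\<open>H X Y\<close> is a retraction of \<open>f \<mapsto> G f\<close> on \<open>hom D X Y\<close>; the second conjunct is naturality
  with respect to \<open>Hom\<^sub>C(G-, G-)\<close> and \<open>Hom\<^sub>D(-, -)\<close> as bifunctors on \<open>D\<^sup>o\<^sup>p \<times> D\<close>.\<close>

definition separable_functor ::
  "('o1, 'm1) category \<Rightarrow> ('o2, 'm2) category \<Rightarrow> ('o1, 'm1, 'o2, 'm2) cat_functor \<Rightarrow> bool" where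
  "separable_functor D C G \<longleftrightarrow> cat_functor D C G \<and>
     (\<exists>H :: 'o1 \<Rightarrow> 'o1 \<Rightarrow> 'm2 \<Rightarrow> 'm1.
        (\<forall>X \<in> Obj D. \<forall>Y \<in> Obj D. \<forall>k \<in> hom C (fobj G X) (fobj G Y). H X Y k \<in> hom D X Y) \<and>
        (\<forall>X \<in> Obj D. \<forall>Y \<in> Obj D. \<forall>X' \<in> Obj D. \<forall>Y' \<in> Obj D.
           \<forall>a \<in> hom D X' X. \<forall>b \<in> hom D Y Y'. \<forall>k \<in> hom C (fobj G X) (fobj G Y).
             H X' Y' (farr G b \<cdot>\<^bsub>C\<^esub> k \<cdot>\<^bsub>C\<^esub> farr G a) = b \<cdot>\<^bsub>D\<^esub> H X Y k \<cdot>\<^bsub>D\<^esub> a) \<and>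
        (\<forall>X \<in> Obj D. \<forall>Y \<in> Obj D. \<forall>f \<in> hom D X Y. H X Y (farr G f) = f))"

locale adjunction = F: cat_functor C D F + G: cat_functor D C G
    + unit: nat_trans C C id_functor "G \<odot> F" \<eta>
    + counit: nat_trans D D "F \<odot> G" id_functor \<epsilon>
  for C :: "('o1, 'm1) category" and D :: "('o2, 'm2) category"
    and F :: "('o1, 'm1, 'o2, 'm2) cat_functor" and G :: "('o2, 'm2, 'o1, 'm1) cat_functor"
    and \<eta> :: "'o1 \<Rightarrow> 'm1" and \<epsilon> :: "'o2 \<Rightarrow> 'm2" +
  assumes triangle_F: "X \<in> Obj C \<Longrightarrow> \<epsilon> (fobj F X) \<cdot>\<^bsub>D\<^esub> farr F (\<eta> X) = Ide D (fobj F X)"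
    and triangle_G: "Y \<in> Obj D \<Longrightarrow> farr G (\<epsilon> Y) \<cdot>\<^bsub>C\<^esub> \<eta> (fobj G Y) = Ide C (fobj G Y)"

record ('o, 'm) monad =
  mfun :: "('o, 'm, 'o, 'm) cat_functor"
  munit :: "'o \<Rightarrow> 'm"
  mmult :: "'o \<Rightarrow> 'm"

locale monad = T: cat_functor C C "mfun M"
    + unit: nat_trans C C id_functor "mfun M" "munit M"
    + mult: nat_trans C C "mfun M \<odot> mfun M" "mfun M" "mmult M"
  for C :: "('o, 'm) category" and M :: "('o, 'm) monad" +
  assumes mult_assoc: "X \<in> Obj C \<Longrightarrow>
      mmult M X \<cdot>\<^bsub>C\<^esub> farr (mfun M) (mmult M X) = mmult M X \<cdot>\<^bsub>C\<^esub> mmult M (fobj (mfun M) X)"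
    and mult_unit_left: "X \<in> Obj C \<Longrightarrow>
      mmult M X \<cdot>\<^bsub>C\<^esub> farr (mfun M) (munit M X) = Ide C (fobj (mfun M) X)"
    and mult_unit_right: "X \<in> Obj C \<Longrightarrow>
      mmult M X \<cdot>\<^bsub>C\<^esub> munit M (fobj (mfun M) X) = Ide C (fobj (mfun M) X)"

definition separable_monad :: "('o, 'm) category \<Rightarrow> ('o, 'm) monad \<Rightarrow> bool" where
  "separable_monad C M \<longleftrightarrow> monad C M \<and>
     (\<exists>\<sigma>. nat_trans C C (mfun M) (mfun M \<odot> mfun M) \<sigma> \<and>
        (\<forall>X \<in> Obj C.
           mmult M X \<cdot>\<^bsub>C\<^esub> \<sigma> X = Ide C (fobj (mfun M) X) \<and>
           farr (mfun M) (mmult M X) \<cdot>\<^bsub>C\<^esub> \<sigma> (fobj (mfun M) X) = \<sigma> X \<cdot>\<^bsub>C\<^esub> mmult M X \<and>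
           \<sigma> X \<cdot>\<^bsub>C\<^esub> mmult M X = mmult M (fobj (mfun M) X) \<cdot>\<^bsub>C\<^esub> farr (mfun M) (\<sigma> X)))"

definition is_module :: "('o, 'm) category \<Rightarrow> ('o, 'm) monad \<Rightarrow> 'o \<times> 'm \<Rightarrow> bool" where
  "is_module C M = (\<lambda>(X, l). X \<in> Obj C \<and> l \<in> hom C (fobj (mfun M) X) X \<and>
     l \<cdot>\<^bsub>C\<^esub> farr (mfun M) l = l \<cdot>\<^bsub>C\<^esub> mmult M X \<and> l \<cdot>\<^bsub>C\<^esub> munit M X = Ide C X)"

definition is_module_hom ::
  "('o, 'm) category \<Rightarrow> ('o, 'm) monad \<Rightarrow> 'o \<times> 'm \<Rightarrow> 'o \<times> 'm \<Rightarrow> 'm \<Rightarrow> bool" where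
  "is_module_hom C M = (\<lambda>(X, l) (X', l') f.
     f \<in> hom C X X' \<and> f \<cdot>\<^bsub>C\<^esub> l = l' \<cdot>\<^bsub>C\<^esub> farr (mfun M) f)"

text \<open>Arrows of the module category carry their source and target modules, because one arrow
  of \<open>C\<close> may underlie module morphisms between different pairs of modules.\<close>

definition Mod ::
  "('o, 'm) category \<Rightarrow> ('o, 'm) monad
     \<Rightarrow> ('o \<times> 'm, ('o \<times> 'm) \<times> 'm \<times> ('o \<times> 'm)) category" where
  "Mod C M = \<lparr>
     Obj = {P. is_module C M P},
     Arr = {(P, f, Q). is_module C M P \<and> is_module C M Q \<and> is_module_hom C M P Q f},
     Dom = (\<lambda>(P, f, Q). P),
     Cod = (\<lambda>(P, f, Q). Q),
     Ide = (\<lambda>P. (P, Ide C (fst P), P)),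
     Comp = (\<lambda>(Q, g, R) (P, f, Q'). (P, g \<cdot>\<^bsub>C\<^esub> f, R))\<rparr>"

definition adj_monad ::
  "('o1, 'm1, 'o2, 'm2) cat_functor \<Rightarrow> ('o2, 'm2, 'o1, 'm1) cat_functor
     \<Rightarrow> ('o1 \<Rightarrow> 'm1) \<Rightarrow> ('o2 \<Rightarrow> 'm2) \<Rightarrow> ('o1, 'm1) monad" where
  "adj_monad F G \<eta> \<epsilon> =
     \<lparr>mfun = G \<odot> F, munit = \<eta>, mmult = \<lambda>X. farr G (\<epsilon> (fobj F X))\<rparr>"

definition comparison_obj ::
  "('o2, 'm2, 'o1, 'm1) cat_functor \<Rightarrow> ('o2 \<Rightarrow> 'm2) \<Rightarrow> 'o2 \<Rightarrow> 'o1 \<times> 'm1" where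
  "comparison_obj G \<epsilon> Y = (fobj G Y, farr G (\<epsilon> Y))"

definition comparison_functor ::
  "('o2, 'm2) category \<Rightarrow> ('o2, 'm2, 'o1, 'm1) cat_functor \<Rightarrow> ('o2 \<Rightarrow> 'm2)
     \<Rightarrow> ('o2, 'm2, 'o1 \<times> 'm1, ('o1 \<times> 'm1) \<times> 'm1 \<times> ('o1 \<times> 'm1)) cat_functor" where
  "comparison_functor D G \<epsilon> = \<lparr>
     fobj = comparison_obj G \<epsilon>,
     farr = \<lambda>f. (comparison_obj G \<epsilon> (Dom D f), farr G f, comparison_obj G \<epsilon> (Cod D f))\<rparr>"

end

theory Submission
  imports Defs
begin

text \<open>Both sides of the equivalence are governed by natural sections \<open>\<nu>\<close> of the counit, that is,
  natural transformations \<open>\<nu> : Id \<rightarrow> FG\<close> with \<open>\<epsilon> \<nu> = Id\<close> (locale \<open>split_counit\<close>).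

  Such a section turns every \<open>k : G X \<rightarrow> G Y\<close> into the arrow \<open>\<epsilon>\<^sub>Y (F k) \<nu>\<^sub>X : X \<rightarrow> Y\<close>, which is
  natural and undoes \<open>G\<close>. Conversely, applying the retractions \<open>H\<close> of a separable \<open>G\<close> to the
  components \<open>\<eta>\<^bsub>G Y\<^esub> : G Y \<rightarrow> G F G Y\<close> yields a section, because \<open>G \<epsilon>\<close> is a left inverse of
  \<open>\<eta> G\<close>. Hence \<open>G\<close> is separable exactly when the counit has a natural section
  (\<open>separable_right_adjoint\<close>, \<open>split_counit_if_separable\<close>).

  Given \<open>\<nu>\<close>, the transformation \<open>\<sigma> = G \<nu> F\<close> makes the monad separable: its two bimodule laws are
  the naturality of \<open>\<nu>\<close> at \<open>\<epsilon>\<close> and the naturality of \<open>\<epsilon>\<close> at \<open>\<nu>\<close>. The comparison functor is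
  fully faithful since the arrow built from \<open>k\<close> is mapped by \<open>G\<close> to \<open>k\<close> as soon as \<open>k\<close> is a
  morphism of modules. It is essentially surjective because a module \<open>(X, l)\<close> is a retract of the
  free module \<open>K (F X)\<close>, and the corresponding idempotent of \<open>K (F X)\<close> comes from the idempotent
  \<open>e = (F l) \<nu>\<^bsub>F X\<^esub>\<close> of \<open>F X\<close>; an object that splits \<open>e\<close> is mapped by \<open>K\<close> to a module
  isomorphic to \<open>(X, l)\<close> (\<open>comparison_essentially_surjective\<close>).

  In the other direction, a separable monad splits the action \<open>l : M X \<rightarrow> X\<close> of each of its modules
  by a morphism of modules, naturally in the module (\<open>action_section_splits\<close>,
  \<open>action_section_natural\<close>). The action of the module \<open>K Y\<close> is the image \<open>G \<epsilon>\<^sub>Y\<close> of the counit, so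
  a fully faithful \<open>K\<close> lifts these splittings to a natural section of \<open>\<epsilon>\<close>.\<close>

section \<open>Arrows with their domains and codomains\<close>

text \<open>The laws of a category are restated for arrows whose domains and codomains match. In this form
  the side conditions are equations that the simplifier computes, and composites are normalised to
  the right without naming the hom-sets of their factors.\<close>

context category
begin

lemma ide_arr [simp]:
  assumes "X \<in> Obj C"
  shows "Ide C X \<in> Arr C" "Dom C (Ide C X) = X" "Cod C (Ide C X) = X"
  using ide_hom[OF assms] by (simp_all add: hom_def)

lemma comp_arr [simp]:
  assumes "f \<in> Arr C" "g \<in> Arr C" "Cod C f = Dom C g"
  shows "g \<cdot> f \<in> Arr C" "Dom C (g \<cdot> f) = Dom C f" "Cod C (g \<cdot> f) = Cod C g"
  using comp_hom[of f "Dom C f" "Cod C f" g "Cod C g"] assms by (simp_all add: hom_def)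

lemma comp_assoc_arr [simp]:
  assumes "f \<in> Arr C" "g \<in> Arr C" "h \<in> Arr C" "Cod C f = Dom C g" "Cod C g = Dom C h"
  shows "(h \<cdot> g) \<cdot> f = h \<cdot> (g \<cdot> f)"
  using assms comp_assoc[of f "Dom C f" "Cod C f" g "Cod C g" h "Cod C h"] by (simp add: hom_def)

lemma comp_ide_arr [simp]:
  assumes "f \<in> Arr C"
  shows "Cod C f = X \<Longrightarrow> Ide C X \<cdot> f = f" "Dom C f = X \<Longrightarrow> f \<cdot> Ide C X = f"
  using assms comp_ide_left[of f "Dom C f" "Cod C f"] comp_ide_right[of f "Dom C f" "Cod C f"]
  by (auto simp: hom_def)

declare dom_obj [simp] cod_obj [simp]

text \<open>In right-normalised composites \<open>g \<cdot> f\<close> is no longer a subterm once a factor \<open>k\<close> precedes it, so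
  an equation for \<open>g \<cdot> f\<close> has to be made applicable there.\<close>

lemma comp_rewrite:
  assumes "g \<cdot> f = h"
    and "f \<in> Arr C" "g \<in> Arr C" "k \<in> Arr C" "Cod C k = Dom C f" "Cod C f = Dom C g"
  shows "g \<cdot> (f \<cdot> k) = h \<cdot> k"
  using assms by (simp flip: assms(1))

end

lemma functor_simps [simp]:
  "fobj id_functor X = X" "farr id_functor f = f"
  "fobj (P \<odot> Q) X = fobj P (fobj Q X)" "farr (P \<odot> Q) f = farr P (farr Q f)"
  by (simp_all add: id_functor_def comp_functor_def)

context cat_functor
begin

declare map_obj [simp] map_ide [simp]

lemma map_arr [simp]:
  assumes "f \<in> Arr A"
  shows "farr F f \<in> Arr B" "Dom B (farr F f) = fobj F (Dom A f)"
    "Cod B (farr F f) = fobj F (Cod A f)"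
  using map_hom[of f "Dom A f" "Cod A f"] assms by (simp_all add: hom_def)

lemma map_comp_arr [simp]:
  assumes "f \<in> Arr A" "g \<in> Arr A" "Cod A f = Dom A g"
  shows "farr F (g \<cdot>\<^bsub>A\<^esub> f) = farr F g \<cdot>\<^bsub>B\<^esub> farr F f"
  using map_comp[of f "Dom A f" "Cod A f" g "Cod A g"] assms by (simp add: hom_def)

end

lemma cat_functor_id: "category A \<Longrightarrow> cat_functor A A id_functor"
  by (simp add: cat_functor_def cat_functor_axioms_def)

lemma cat_functor_comp:
  assumes "cat_functor A B P" "cat_functor B E Q"
  shows "cat_functor A E (Q \<odot> P)"
proof -
  interpret P: cat_functor A B P by fact
  interpret Q: cat_functor B E Q by fact
  show ?thesis
    by unfold_locales (auto simp: hom_def)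
qed

context nat_trans
begin

lemma component_arr [simp]:
  assumes "X \<in> Obj A"
  shows "\<tau> X \<in> Arr B" "Dom B (\<tau> X) = fobj F X" "Cod B (\<tau> X) = fobj G X"
  using component[OF assms] by (simp_all add: hom_def)

lemma naturality_arr:
  assumes "f \<in> Arr A" "Dom A f = X" "Cod A f = Y"
  shows "farr G f \<cdot>\<^bsub>B\<^esub> \<tau> X = \<tau> Y \<cdot>\<^bsub>B\<^esub> farr F f"
  using naturality[of f X Y] assms by (simp add: hom_def)

end

section \<open>Equivalences as fully faithful, essentially surjective functors\<close>

definition faithful where
  "faithful A B F \<longleftrightarrow> (\<forall>X \<in> Obj A. \<forall>Y \<in> Obj A. \<forall>f \<in> hom A X Y. \<forall>f' \<in> hom A X Y.
     farr F f = farr F f' \<longrightarrow> f = f')"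

definition full where
  "full A B F \<longleftrightarrow> (\<forall>X \<in> Obj A. \<forall>Y \<in> Obj A. \<forall>g \<in> hom B (fobj F X) (fobj F Y).
     \<exists>f \<in> hom A X Y. farr F f = g)"

definition essentially_surjective where
  "essentially_surjective A B F \<longleftrightarrow>
     (\<forall>Y \<in> Obj B. \<exists>X \<in> Obj A. \<exists>b. is_iso B (fobj F X) Y b)"

lemma faithfulD:
  assumes "faithful A B F" "category A" "f \<in> Arr A" "f' \<in> Arr A"
    "Dom A f = Dom A f'" "Cod A f = Cod A f'" "farr F f = farr F f'"
  shows "f = f'"
  using assms category.dom_obj[OF assms(2), of f'] category.cod_obj[OF assms(2), of f']
  unfolding faithful_def hom_def by blast

text \<open>The invertible \<open>\<alpha>\<close> recovers \<open>f\<close> from \<open>L (F f)\<close> by conjugation.\<close>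

lemma faithful_if_left_inverse:
  assumes "cat_functor A B F" "cat_functor B A L" "nat_iso A A id_functor (L \<odot> F) \<alpha>"
  shows "faithful A B F"
proof -
  interpret F: cat_functor A B F by fact
  interpret L: cat_functor B A L by fact
  interpret \<alpha>: nat_trans A A id_functor "L \<odot> F" \<alpha>
    using assms(3) by (simp add: nat_iso_def)
  show ?thesis
    unfolding faithful_def
  proof (intro ballI impI)
    fix X Y f f'
    assume X: "X \<in> Obj A" and Y: "Y \<in> Obj A" and f: "f \<in> hom A X Y" and f': "f' \<in> hom A X Y"
      and eq: "farr F f = farr F f'"
    obtain a where a: "a \<in> hom A (fobj L (fobj F Y)) Y" "a \<cdot>\<^bsub>A\<^esub> \<alpha> Y = Ide A Y"
      using assms(3) Y by (auto simp: nat_iso_def is_iso_def)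
    have "h = a \<cdot>\<^bsub>A\<^esub> (farr L (farr F h) \<cdot>\<^bsub>A\<^esub> \<alpha> X)" if "h \<in> hom A X Y" for h
    proof -
      have "h = (a \<cdot>\<^bsub>A\<^esub> \<alpha> Y) \<cdot>\<^bsub>A\<^esub> h" using a that by (simp add: hom_def)
      also have "\<dots> = a \<cdot>\<^bsub>A\<^esub> (\<alpha> Y \<cdot>\<^bsub>A\<^esub> h)" using a(1) that Y by (simp add: hom_def)
      also have "\<alpha> Y \<cdot>\<^bsub>A\<^esub> h = farr L (farr F h) \<cdot>\<^bsub>A\<^esub> \<alpha> X"
        using \<alpha>.naturality[OF that] by simp
      finally show ?thesis .
    qed
    from this[OF f] this[OF f'] show "f = f'" by (simp add: eq)
  qed
qed

lemma faithful_if_right_inverse: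
  assumes "cat_functor A B F" "cat_functor B A L" "nat_iso B B (F \<odot> L) id_functor \<beta>"
  shows "faithful B A L"
proof -
  interpret F: cat_functor A B F by fact
  interpret L: cat_functor B A L by fact
  interpret \<beta>: nat_trans B B "F \<odot> L" id_functor \<beta>
    using assms(3) by (simp add: nat_iso_def)
  show ?thesis
    unfolding faithful_def
  proof (intro ballI impI)
    fix X Y g g'
    assume X: "X \<in> Obj B" and Y: "Y \<in> Obj B" and g: "g \<in> hom B X Y" and g': "g' \<in> hom B X Y"
      and eq: "farr L g = farr L g'"
    obtain b where b: "b \<in> hom B X (fobj F (fobj L X))" "\<beta> X \<cdot>\<^bsub>B\<^esub> b = Ide B X"
      using assms(3) X by (auto simp: nat_iso_def is_iso_def)
    have "h = (\<beta> Y \<cdot>\<^bsub>B\<^esub> farr F (farr L h)) \<cdot>\<^bsub>B\<^esub> b" if "h \<in> hom B X Y" for h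
    proof -
      have "\<beta> Y \<cdot>\<^bsub>B\<^esub> farr F (farr L h) = h \<cdot>\<^bsub>B\<^esub> \<beta> X"
        using \<beta>.naturality[OF that] by simp
      then show ?thesis using that X Y b by (simp add: hom_def)
    qed
    from this[OF g] this[OF g'] show "g = g'" by (simp add: eq)
  qed
qed

text \<open>For fullness, a given \<open>g : F X \<rightarrow> F Y\<close> is transported by \<open>L\<close> and conjugated by \<open>\<alpha>\<close> to an
  arrow \<open>f : X \<rightarrow> Y\<close>. Then \<open>L (F f) = L g\<close>, and \<open>L\<close> is faithful too.\<close>

lemma equivalence_fully_faithful:
  assumes "equivalence_of_categories A B F"
  shows "faithful A B F" "full A B F"
proof -
  from assms obtain L \<alpha> \<beta> where F: "cat_functor A B F" and L: "cat_functor B A L"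
    and \<alpha>: "nat_iso A A id_functor (L \<odot> F) \<alpha>" and \<beta>: "nat_iso B B (F \<odot> L) id_functor \<beta>"
    by (auto simp: equivalence_of_categories_def)
  interpret F: cat_functor A B F by fact
  interpret L: cat_functor B A L by fact
  interpret \<alpha>: nat_trans A A id_functor "L \<odot> F" \<alpha>
    using \<alpha> by (simp add: nat_iso_def)
  show "faithful A B F" using faithful_if_left_inverse[OF F L \<alpha>] .
  have L_faithful: "faithful B A L" using faithful_if_right_inverse[OF F L \<beta>] .
  show "full A B F"
    unfolding full_def
  proof (intro ballI)
    fix X Y g assume X: "X \<in> Obj A" and Y: "Y \<in> Obj A" and g: "g \<in> hom B (fobj F X) (fobj F Y)"
    obtain x where x: "x \<in> hom A (fobj L (fobj F X)) X" "\<alpha> X \<cdot>\<^bsub>A\<^esub> x = Ide A (fobj L (fobj F X))"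
      using \<alpha> X by (auto simp: nat_iso_def is_iso_def)
    obtain y where y: "y \<in> hom A (fobj L (fobj F Y)) Y" "\<alpha> Y \<cdot>\<^bsub>A\<^esub> y = Ide A (fobj L (fobj F Y))"
      using \<alpha> Y by (auto simp: nat_iso_def is_iso_def)
    define f where "f = y \<cdot>\<^bsub>A\<^esub> farr L g \<cdot>\<^bsub>A\<^esub> \<alpha> X"
    have f: "f \<in> hom A X Y" using X Y g y by (simp add: f_def hom_def)
    have "farr L (farr F f) = (farr L (farr F f) \<cdot>\<^bsub>A\<^esub> \<alpha> X) \<cdot>\<^bsub>A\<^esub> x"
      using X Y f x by (simp add: hom_def)
    also have "\<dots> = (\<alpha> Y \<cdot>\<^bsub>A\<^esub> f) \<cdot>\<^bsub>A\<^esub> x"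
      using \<alpha>.naturality[OF f] by simp
    also have "\<dots> = ((\<alpha> Y \<cdot>\<^bsub>A\<^esub> y) \<cdot>\<^bsub>A\<^esub> farr L g) \<cdot>\<^bsub>A\<^esub> (\<alpha> X \<cdot>\<^bsub>A\<^esub> x)"
      using X Y g x(1) y(1) by (simp add: f_def hom_def)
    also have "\<dots> = farr L g"
      using X Y g x y by (simp add: hom_def)
    finally have "farr F f = g"
      using f g by (intro faithfulD[OF L_faithful F.B.category_axioms]) (auto simp: hom_def)
    with f show "\<exists>f \<in> hom A X Y. farr F f = g" by blast
  qed
qed

text \<open>The inverse \<open>L\<close> picks for each \<open>Y\<close> an object \<open>l Y\<close> with an isomorphism \<open>b Y\<close> from
  \<open>F (l Y)\<close> to \<open>Y\<close>, and sends \<open>g\<close> to the only arrow over its conjugate by \<open>b\<close>. All equations in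
  the source category follow by comparing images under the faithful \<open>F\<close>.\<close>

lemma equivalence_if_fully_faithful:
  assumes "cat_functor A B F" and faithful: "faithful A B F" and full: "full A B F"
    and surj: "essentially_surjective A B F"
  shows "equivalence_of_categories A B F"
proof -
  interpret F: cat_functor A B F by fact
  have "\<forall>Y \<in> Obj B. \<exists>X b b'. X \<in> Obj A \<and> b \<in> hom B (fobj F X) Y \<and> b' \<in> hom B Y (fobj F X)
      \<and> b' \<cdot>\<^bsub>B\<^esub> b = Ide B (fobj F X) \<and> b \<cdot>\<^bsub>B\<^esub> b' = Ide B Y"
    using surj unfolding essentially_surjective_def is_iso_def by blast
  then obtain l b b' where lb: "\<forall>Y \<in> Obj B. l Y \<in> Obj A \<and> b Y \<in> hom B (fobj F (l Y)) Y
      \<and> b' Y \<in> hom B Y (fobj F (l Y))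
      \<and> b' Y \<cdot>\<^bsub>B\<^esub> b Y = Ide B (fobj F (l Y)) \<and> b Y \<cdot>\<^bsub>B\<^esub> b' Y = Ide B Y"
    by metis
  then have b [simp]: "l Y \<in> Obj A"
    "b Y \<in> Arr B" "Dom B (b Y) = fobj F (l Y)" "Cod B (b Y) = Y"
    "b' Y \<in> Arr B" "Dom B (b' Y) = Y" "Cod B (b' Y) = fobj F (l Y)"
    "b' Y \<cdot>\<^bsub>B\<^esub> b Y = Ide B (fobj F (l Y))" "b Y \<cdot>\<^bsub>B\<^esub> b' Y = Ide B Y" if "Y \<in> Obj B" for Y
    using that by (auto simp: hom_def)
  have b_cancel [simp]: "b Y \<cdot>\<^bsub>B\<^esub> (b' Y \<cdot>\<^bsub>B\<^esub> k) = k"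
    if "Y \<in> Obj B" "k \<in> Arr B" "Cod B k = Y" for Y k
    using that by (simp add: F.B.comp_rewrite[of "b Y" "b' Y"])
  obtain lift where "\<And>X Y g. X \<in> Obj A \<Longrightarrow> Y \<in> Obj A \<Longrightarrow> g \<in> hom B (fobj F X) (fobj F Y)
      \<Longrightarrow> lift X Y g \<in> hom A X Y \<and> farr F (lift X Y g) = g"
    using full unfolding full_def by metis
  then have lift [simp]: "lift X Y g \<in> Arr A" "Dom A (lift X Y g) = X" "Cod A (lift X Y g) = Y"
    "farr F (lift X Y g) = g"
    if "X \<in> Obj A" "Y \<in> Obj A" "g \<in> Arr B" "Dom B g = fobj F X" "Cod B g = fobj F Y" for X Y g
    using that by (auto simp: hom_def)
  note unique = faithfulD[OF faithful F.A.category_axioms]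
  define L where "L = \<lparr>fobj = l,
    farr = \<lambda>g. lift (l (Dom B g)) (l (Cod B g)) (b' (Cod B g) \<cdot>\<^bsub>B\<^esub> g \<cdot>\<^bsub>B\<^esub> b (Dom B g))\<rparr>"
  have L_simps [simp]: "fobj L Y = l Y"
    "farr L g = lift (l (Dom B g)) (l (Cod B g)) (b' (Cod B g) \<cdot>\<^bsub>B\<^esub> g \<cdot>\<^bsub>B\<^esub> b (Dom B g))" for Y g
    by (simp_all add: L_def)
  interpret L: cat_functor B A L
  proof
    show "fobj L X \<in> Obj A" if "X \<in> Obj B" for X using that by simp
    show "farr L f \<in> hom A (fobj L X) (fobj L Y)" if "f \<in> hom B X Y" for f X Y
      using that by (auto simp: hom_def)
    show "farr L (Ide B X) = Ide A (fobj L X)" if "X \<in> Obj B" for X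
      by (rule unique) (use that in simp_all)
    show "farr L (g \<cdot>\<^bsub>B\<^esub> f) = farr L g \<cdot>\<^bsub>A\<^esub> farr L f"
      if "f \<in> hom B X Y" "g \<in> hom B Y Z" for f g X Y Z
      by (rule unique) (use that in \<open>auto simp: hom_def\<close>)
  qed
  define \<alpha> where "\<alpha> X = lift X (l (fobj F X)) (b' (fobj F X))" for X
  define \<alpha>' where "\<alpha>' X = lift (l (fobj F X)) X (b (fobj F X))" for X
  have LF: "cat_functor A A (L \<odot> F)" and FL: "cat_functor B B (F \<odot> L)"
    by (auto intro: cat_functor_comp F.cat_functor_axioms L.cat_functor_axioms)
  have "nat_trans A A id_functor (L \<odot> F) \<alpha>"
  proof (intro nat_trans.intro nat_trans_axioms.intro cat_functor_id F.A.category_axioms LF)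
    show "\<alpha> X \<in> hom A (fobj id_functor X) (fobj (L \<odot> F) X)" if "X \<in> Obj A" for X
      using that by (simp add: \<alpha>_def hom_def)
    show "farr (L \<odot> F) f \<cdot>\<^bsub>A\<^esub> \<alpha> X = \<alpha> Y \<cdot>\<^bsub>A\<^esub> farr id_functor f" if "f \<in> hom A X Y" for f X Y
      by (rule unique) (use that in \<open>auto simp: \<alpha>_def hom_def\<close>)
  qed
  moreover have "is_iso A X (l (fobj F X)) (\<alpha> X)" if "X \<in> Obj A" for X
    unfolding is_iso_def
  proof (intro conjI bexI)
    show "\<alpha>' X \<cdot>\<^bsub>A\<^esub> \<alpha> X = Ide A X" "\<alpha> X \<cdot>\<^bsub>A\<^esub> \<alpha>' X = Ide A (l (fobj F X))"
      by (rule unique; use that in \<open>simp add: \<alpha>_def \<alpha>'_def\<close>)+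
  qed (use that in \<open>simp_all add: \<alpha>_def \<alpha>'_def hom_def\<close>)
  ultimately have \<alpha>: "nat_iso A A id_functor (L \<odot> F) \<alpha>"
    by (simp add: nat_iso_def)
  have "nat_trans B B (F \<odot> L) id_functor b"
  proof (intro nat_trans.intro nat_trans_axioms.intro cat_functor_id F.B.category_axioms FL)
    show "b X \<in> hom B (fobj (F \<odot> L) X) (fobj id_functor X)" if "X \<in> Obj B" for X
      using that by (simp add: hom_def)
    show "farr id_functor f \<cdot>\<^bsub>B\<^esub> b X = b Y \<cdot>\<^bsub>B\<^esub> farr (F \<odot> L) f" if "f \<in> hom B X Y" for f X Y
      using that by (auto simp: hom_def)
  qed
  moreover have "is_iso B (fobj F (l Y)) Y (b Y)" if "Y \<in> Obj B" for Y
    unfolding is_iso_def by (intro conjI bexI[of _ "b' Y"]) (use that in \<open>simp_all add: hom_def\<close>)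
  ultimately have "nat_iso B B (F \<odot> L) id_functor b"
    by (simp add: nat_iso_def)
  with \<alpha> show ?thesis
    unfolding equivalence_of_categories_def
    using F.cat_functor_axioms L.cat_functor_axioms by blast
qed

section \<open>The category of modules over a monad\<close>

lemma Mod_simps [simp]:
  "Obj (Mod C M) = {P. is_module C M P}"
  "Ide (Mod C M) P = (P, Ide C (fst P), P)"
  "(Q', g, R) \<cdot>\<^bsub>Mod C M\<^esub> (P, f, Q) = (P, g \<cdot>\<^bsub>C\<^esub> f, R)"
  by (simp_all add: Mod_def)

lemma hom_Mod:
  "h \<in> hom (Mod C M) P Q \<longleftrightarrow> is_module C M P \<and> is_module C M Q \<and>
     (\<exists>f. h = (P, f, Q) \<and> f \<in> hom C (fst P) (fst Q) \<and>
        f \<cdot>\<^bsub>C\<^esub> snd P = snd Q \<cdot>\<^bsub>C\<^esub> farr (mfun M) f)"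
  by (cases h; cases P; cases Q) (auto simp: hom_def Mod_def is_module_hom_def)

context monad
begin

lemma category_Mod: "category (Mod C M)"
proof
  show "Dom (Mod C M) f \<in> Obj (Mod C M)" "Cod (Mod C M) f \<in> Obj (Mod C M)"
    if "f \<in> Arr (Mod C M)" for f
    using that by (auto simp: Mod_def)
  show "Ide (Mod C M) P \<in> hom (Mod C M) P P" if "P \<in> Obj (Mod C M)" for P
    using that by (cases P) (auto simp: hom_Mod is_module_def hom_def[of C])
  show "g \<cdot>\<^bsub>Mod C M\<^esub> f \<in> hom (Mod C M) P R"
    if f: "f \<in> hom (Mod C M) P Q" and g: "g \<in> hom (Mod C M) Q R" for f g P Q R
  proof -
    obtain f' g' where [simp]: "f = (P, f', Q)" "g = (Q, g', R)"
      using f g by (auto simp: hom_Mod)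
    obtain X x Y y Z z where [simp]: "P = (X, x)" "Q = (Y, y)" "R = (Z, z)"
      by (cases P, cases Q, cases R)
    have *: "f' \<cdot>\<^bsub>C\<^esub> x = y \<cdot>\<^bsub>C\<^esub> farr (mfun M) f'" "g' \<cdot>\<^bsub>C\<^esub> y = z \<cdot>\<^bsub>C\<^esub> farr (mfun M) g'"
      using f g by (auto simp: hom_Mod)
    have [simp]: "f' \<in> Arr C" "g' \<in> Arr C" "x \<in> Arr C" "y \<in> Arr C" "z \<in> Arr C"
      "Dom C f' = X" "Cod C f' = Y" "Dom C g' = Y" "Cod C g' = Z"
      "Dom C x = fobj (mfun M) X" "Cod C x = X" "Dom C y = fobj (mfun M) Y" "Cod C y = Y"
      "Dom C z = fobj (mfun M) Z" "Cod C z = Z"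
      using f g by (auto simp: hom_Mod is_module_def hom_def[of C])
    have "(g' \<cdot>\<^bsub>C\<^esub> f') \<cdot>\<^bsub>C\<^esub> x = z \<cdot>\<^bsub>C\<^esub> farr (mfun M) (g' \<cdot>\<^bsub>C\<^esub> f')"
      by (simp add: *(1) T.A.comp_rewrite[OF *(2)])
    then show ?thesis using f g by (auto simp: hom_Mod hom_def[of C])
  qed
  show "Ide (Mod C M) Q \<cdot>\<^bsub>Mod C M\<^esub> f = f" "f \<cdot>\<^bsub>Mod C M\<^esub> Ide (Mod C M) P = f"
    if "f \<in> hom (Mod C M) P Q" for f P Q
    using that by (auto simp: hom_Mod hom_def[of C])
  show "(h \<cdot>\<^bsub>Mod C M\<^esub> g) \<cdot>\<^bsub>Mod C M\<^esub> f = h \<cdot>\<^bsub>Mod C M\<^esub> g \<cdot>\<^bsub>Mod C M\<^esub> f"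
    if "f \<in> hom (Mod C M) P Q" "g \<in> hom (Mod C M) Q R" "h \<in> hom (Mod C M) R S" for f g h P Q R S
    using that by (auto simp: hom_Mod hom_def[of C])
qed

text \<open>It suffices that one of two mutually inverse arrows of \<open>C\<close> is a morphism of modules:
  conjugating its defining equation by the inverse gives the equation for the inverse.\<close>

lemma is_iso_Mod:
  assumes P: "is_module C M (X, x)" and Q: "is_module C M (Y, y)"
    and w: "w \<in> hom C X Y" and z: "z \<in> hom C Y X"
    and zw: "z \<cdot>\<^bsub>C\<^esub> w = Ide C X" and wz: "w \<cdot>\<^bsub>C\<^esub> z = Ide C Y"
    and hom: "w \<cdot>\<^bsub>C\<^esub> x = y \<cdot>\<^bsub>C\<^esub> farr (mfun M) w"
  shows "is_iso (Mod C M) (X, x) (Y, y) ((X, x), w, (Y, y))"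
proof -
  note [simp] = P[unfolded is_module_def hom_def, simplified] Q[unfolded is_module_def hom_def, simplified]
    w[unfolded hom_def, simplified] z[unfolded hom_def, simplified]
  have "z \<cdot>\<^bsub>C\<^esub> y = z \<cdot>\<^bsub>C\<^esub> y \<cdot>\<^bsub>C\<^esub> farr (mfun M) (w \<cdot>\<^bsub>C\<^esub> z)"
    unfolding wz by simp
  also have "\<dots> = z \<cdot>\<^bsub>C\<^esub> (y \<cdot>\<^bsub>C\<^esub> farr (mfun M) w) \<cdot>\<^bsub>C\<^esub> farr (mfun M) z"
    by simp
  also have "\<dots> = (z \<cdot>\<^bsub>C\<^esub> w) \<cdot>\<^bsub>C\<^esub> x \<cdot>\<^bsub>C\<^esub> farr (mfun M) z"
    unfolding hom[symmetric] by simp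
  also have "\<dots> = x \<cdot>\<^bsub>C\<^esub> farr (mfun M) z"
    unfolding zw by simp
  finally have "((Y, y), z, (X, x)) \<in> hom (Mod C M) (Y, y) (X, x)"
    using P Q z by (auto simp: hom_Mod)
  moreover have "((X, x), w, (Y, y)) \<in> hom (Mod C M) (X, x) (Y, y)"
    using P Q w hom by (auto simp: hom_Mod)
  ultimately show ?thesis
    using zw wz unfolding is_iso_def by (auto intro!: bexI[of _ "((Y, y), z, (X, x))"])
qed

end

section \<open>The monad and the comparison functor of an adjunction\<close>

lemma adj_monad_simps [simp]:
  "mfun (adj_monad F G \<eta> \<epsilon>) = G \<odot> F" "munit (adj_monad F G \<eta> \<epsilon>) = \<eta>"
  "mmult (adj_monad F G \<eta> \<epsilon>) X = farr G (\<epsilon> (fobj F X))"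
  by (simp_all add: adj_monad_def)

context adjunction
begin

abbreviation M where "M \<equiv> adj_monad F G \<eta> \<epsilon>"
abbreviation K where "K \<equiv> comparison_functor D G \<epsilon>"

lemma counit_natural:
  assumes "f \<in> Arr D" "Dom D f = X" "Cod D f = Y"
  shows "\<epsilon> Y \<cdot>\<^bsub>D\<^esub> farr F (farr G f) = f \<cdot>\<^bsub>D\<^esub> \<epsilon> X"
  using counit.naturality_arr[OF assms] by simp

lemma counit_image_natural:
  assumes "f \<in> Arr D" "Dom D f = X" "Cod D f = Y"
  shows "farr G (\<epsilon> Y) \<cdot>\<^bsub>C\<^esub> farr G (farr F (farr G f)) = farr G f \<cdot>\<^bsub>C\<^esub> farr G (\<epsilon> X)"
  using counit_natural[OF assms] assms by (auto simp flip: G.map_comp_arr)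

lemma monad_adj_monad: "monad C M"
proof -
  have GF: "cat_functor C C (G \<odot> F)"
    by (auto intro: cat_functor_comp F.cat_functor_axioms G.cat_functor_axioms)
  have triangle: "farr G (\<epsilon> (fobj F X)) \<cdot>\<^bsub>C\<^esub> farr G (farr F (\<eta> X)) = Ide C (fobj G (fobj F X))"
    if "X \<in> Obj C" for X
    using triangle_F[OF that] that by (simp flip: G.map_comp_arr)
  show ?thesis
    unfolding monad_def
  proof (intro conjI)
    show "cat_functor C C (mfun M)" using GF by simp
    show "nat_trans C C id_functor (mfun M) (munit M)"
      using unit.nat_trans_axioms by simp
    show "nat_trans C C (mfun M \<odot> mfun M) (mfun M) (mmult M)"
    proof (intro nat_trans.intro nat_trans_axioms.intro)
      show "cat_functor C C (mfun M \<odot> mfun M)" "cat_functor C C (mfun M)"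
        using GF cat_functor_comp[OF GF GF] by simp_all
    qed (auto simp: hom_def counit_image_natural)
    show "monad_axioms C M"
      by unfold_locales (simp_all add: counit_image_natural triangle triangle_G)
  qed
qed

sublocale monad: monad C M
  by (rule monad_adj_monad)

lemma comparison_simps [simp]:
  "fobj K Y = (fobj G Y, farr G (\<epsilon> Y))"
  "f \<in> hom D X Y \<Longrightarrow> farr K f = (fobj K X, farr G f, fobj K Y)"
  by (simp_all add: comparison_functor_def comparison_obj_def hom_def)

lemma comparison_module:
  assumes "Y \<in> Obj D"
  shows "is_module C M (fobj G Y, farr G (\<epsilon> Y))"
  using assms by (simp add: is_module_def hom_def counit_image_natural triangle_G)

lemma cat_functor_comparison: "cat_functor D (Mod C M) K"
proof (intro cat_functor.intro cat_functor_axioms.intro monad.category_Mod F.B.category_axioms)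
  show "fobj K X \<in> Obj (Mod C M)" if "X \<in> Obj D" for X
    using that by (simp add: comparison_module)
  show "farr K f \<in> hom (Mod C M) (fobj K X) (fobj K Y)" if "f \<in> hom D X Y" for f X Y
    using that
    by (simp add: hom_Mod comparison_module counit_image_natural)
       (auto simp: hom_def comparison_module counit_image_natural)
  show "farr K (Ide D X) = Ide (Mod C M) (fobj K X)" if "X \<in> Obj D" for X
    using comparison_simps(2)[OF F.B.ide_hom[OF that]] that by simp
  show "farr K (g \<cdot>\<^bsub>D\<^esub> f) = farr K g \<cdot>\<^bsub>Mod C M\<^esub> farr K f"
    if "f \<in> hom D X Y" "g \<in> hom D Y Z" for f g X Y Z
    using that comparison_simps(2)[OF F.B.comp_hom[OF that]] by (simp add: G.map_comp[OF that])
qed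

end

section \<open>Separable monads split the actions of their modules\<close>

context monad
begin

lemma mult_natural:
  assumes "f \<in> Arr C" "Dom C f = X" "Cod C f = Y"
  shows "mmult M Y \<cdot>\<^bsub>C\<^esub> farr (mfun M) (farr (mfun M) f) = farr (mfun M) f \<cdot>\<^bsub>C\<^esub> mmult M X"
  using mult.naturality_arr[OF assms] by simp

end

locale split_monad = monad C M for C :: "('o, 'm) category" and M :: "('o, 'm) monad" +
  fixes \<sigma> :: "'o \<Rightarrow> 'm"
  assumes split_nat_trans: "nat_trans C C (mfun M) (mfun M \<odot> mfun M) \<sigma>"
    and mult_split: "X \<in> Obj C \<Longrightarrow> mmult M X \<cdot>\<^bsub>C\<^esub> \<sigma> X = Ide C (fobj (mfun M) X)"
    and split_left: "X \<in> Obj C \<Longrightarrow>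
      farr (mfun M) (mmult M X) \<cdot>\<^bsub>C\<^esub> \<sigma> (fobj (mfun M) X) = \<sigma> X \<cdot>\<^bsub>C\<^esub> mmult M X"
    and split_right: "X \<in> Obj C \<Longrightarrow>
      \<sigma> X \<cdot>\<^bsub>C\<^esub> mmult M X = mmult M (fobj (mfun M) X) \<cdot>\<^bsub>C\<^esub> farr (mfun M) (\<sigma> X)"
begin

sublocale \<sigma>: nat_trans C C "mfun M" "mfun M \<odot> mfun M" \<sigma>
  by (rule split_nat_trans)

text \<open>Only the free action \<open>\<mu>\<close> is split by \<open>\<sigma>\<close> itself. For an arbitrary action \<open>l : M X \<rightarrow> X\<close>, this
  splitting is restricted along \<open>\<eta> : X \<rightarrow> M X\<close> and pushed forward along \<open>M l : M M X \<rightarrow> M X\<close>.\<close>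

definition action_section :: "'o \<times> 'm \<Rightarrow> 'm" where
  "action_section P =
     farr (mfun M) (snd P) \<cdot>\<^bsub>C\<^esub> \<sigma> (fst P) \<cdot>\<^bsub>C\<^esub> munit M (fst P)"

text \<open>With \<open>s\<close> for the section, both \<open>s \<circ> l\<close> and \<open>\<mu> \<circ> M s\<close> reduce to \<open>M l \<circ> \<sigma>\<close>, so \<open>s\<close> is a
  morphism of modules. In each case one of the two laws of \<open>\<sigma>\<close> produces the factor \<open>\<sigma> \<circ> \<mu>\<close>, in
  which \<open>\<mu>\<close> cancels the unit contained in \<open>s\<close>.\<close>

lemma action_section_splits:
  assumes P: "is_module C M (X, l)"
  shows "action_section (X, l) \<in> hom C X (fobj (mfun M) X)"
    and "l \<cdot>\<^bsub>C\<^esub> action_section (X, l) = Ide C X"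
    and "action_section (X, l) \<cdot>\<^bsub>C\<^esub> l =
      mmult M X \<cdot>\<^bsub>C\<^esub> farr (mfun M) (action_section (X, l))"
proof -
  let ?T = "farr (mfun M)" and ?TX = "fobj (mfun M) X"
  have [simp]: "X \<in> Obj C" "l \<in> Arr C" "Dom C l = ?TX" "Cod C l = X"
    and l_assoc: "l \<cdot>\<^bsub>C\<^esub> ?T l = l \<cdot>\<^bsub>C\<^esub> mmult M X" and l_unit: "l \<cdot>\<^bsub>C\<^esub> munit M X = Ide C X"
    using P by (auto simp: is_module_def hom_def)
  define s where "s = ?T l \<cdot>\<^bsub>C\<^esub> \<sigma> X \<cdot>\<^bsub>C\<^esub> munit M X"
  have s: "action_section (X, l) = s" by (simp add: action_section_def s_def)
  have "s \<in> hom C X ?TX" by (simp add: s_def hom_def)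
  moreover have "l \<cdot>\<^bsub>C\<^esub> s = Ide C X"
  proof -
    have "l \<cdot>\<^bsub>C\<^esub> s = (l \<cdot>\<^bsub>C\<^esub> ?T l) \<cdot>\<^bsub>C\<^esub> \<sigma> X \<cdot>\<^bsub>C\<^esub> munit M X" by (simp add: s_def)
    also have "\<dots> = l \<cdot>\<^bsub>C\<^esub> (mmult M X \<cdot>\<^bsub>C\<^esub> \<sigma> X) \<cdot>\<^bsub>C\<^esub> munit M X" unfolding l_assoc by simp
    also have "\<dots> = Ide C X" by (simp add: mult_split l_unit)
    finally show ?thesis .
  qed
  moreover have "s \<cdot>\<^bsub>C\<^esub> l = ?T l \<cdot>\<^bsub>C\<^esub> \<sigma> X"
  proof -
    have "s \<cdot>\<^bsub>C\<^esub> l = ?T l \<cdot>\<^bsub>C\<^esub> \<sigma> X \<cdot>\<^bsub>C\<^esub> (munit M X \<cdot>\<^bsub>C\<^esub> l)" by (simp add: s_def)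
    also have "munit M X \<cdot>\<^bsub>C\<^esub> l = ?T l \<cdot>\<^bsub>C\<^esub> munit M ?TX"
      using unit.naturality_arr[of l ?TX X] by simp
    also have "?T l \<cdot>\<^bsub>C\<^esub> \<sigma> X \<cdot>\<^bsub>C\<^esub> (?T l \<cdot>\<^bsub>C\<^esub> munit M ?TX) =
        ?T l \<cdot>\<^bsub>C\<^esub> (\<sigma> X \<cdot>\<^bsub>C\<^esub> ?T l) \<cdot>\<^bsub>C\<^esub> munit M ?TX" by simp
    also have "\<sigma> X \<cdot>\<^bsub>C\<^esub> ?T l = ?T (?T l) \<cdot>\<^bsub>C\<^esub> \<sigma> ?TX"
      using \<sigma>.naturality_arr[of l ?TX X] by simp
    also have "?T l \<cdot>\<^bsub>C\<^esub> (?T (?T l) \<cdot>\<^bsub>C\<^esub> \<sigma> ?TX) \<cdot>\<^bsub>C\<^esub> munit M ?TX =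
        ?T (l \<cdot>\<^bsub>C\<^esub> ?T l) \<cdot>\<^bsub>C\<^esub> \<sigma> ?TX \<cdot>\<^bsub>C\<^esub> munit M ?TX" by simp
    also have "\<dots> = ?T l \<cdot>\<^bsub>C\<^esub> (?T (mmult M X) \<cdot>\<^bsub>C\<^esub> \<sigma> ?TX) \<cdot>\<^bsub>C\<^esub> munit M ?TX"
      unfolding l_assoc by simp
    also have "\<dots> = ?T l \<cdot>\<^bsub>C\<^esub> \<sigma> X \<cdot>\<^bsub>C\<^esub> (mmult M X \<cdot>\<^bsub>C\<^esub> munit M ?TX)"
      by (simp add: split_left)
    also have "\<dots> = ?T l \<cdot>\<^bsub>C\<^esub> \<sigma> X" by (simp add: mult_unit_right)
    finally show ?thesis .
  qed
  moreover have "mmult M X \<cdot>\<^bsub>C\<^esub> ?T s = ?T l \<cdot>\<^bsub>C\<^esub> \<sigma> X"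
  proof -
    have "mmult M X \<cdot>\<^bsub>C\<^esub> ?T s =
        (mmult M X \<cdot>\<^bsub>C\<^esub> ?T (?T l)) \<cdot>\<^bsub>C\<^esub> ?T (\<sigma> X) \<cdot>\<^bsub>C\<^esub> ?T (munit M X)" by (simp add: s_def)
    also have "\<dots> = ?T l \<cdot>\<^bsub>C\<^esub> (mmult M ?TX \<cdot>\<^bsub>C\<^esub> ?T (\<sigma> X)) \<cdot>\<^bsub>C\<^esub> ?T (munit M X)"
      by (simp add: mult_natural)
    also have "\<dots> = ?T l \<cdot>\<^bsub>C\<^esub> \<sigma> X \<cdot>\<^bsub>C\<^esub> (mmult M X \<cdot>\<^bsub>C\<^esub> ?T (munit M X))"
      by (simp flip: split_right)
    also have "\<dots> = ?T l \<cdot>\<^bsub>C\<^esub> \<sigma> X" by (simp add: mult_unit_left)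
    finally show ?thesis .
  qed
  ultimately show "action_section (X, l) \<in> hom C X (fobj (mfun M) X)"
    "l \<cdot>\<^bsub>C\<^esub> action_section (X, l) = Ide C X"
    "action_section (X, l) \<cdot>\<^bsub>C\<^esub> l =
      mmult M X \<cdot>\<^bsub>C\<^esub> farr (mfun M) (action_section (X, l))"
    by (simp_all add: s)
qed

lemma action_section_natural:
  assumes "is_module C M (X, l)" "is_module C M (X', l')"
    and f: "f \<in> hom C X X'" and hom: "f \<cdot>\<^bsub>C\<^esub> l = l' \<cdot>\<^bsub>C\<^esub> farr (mfun M) f"
  shows "farr (mfun M) f \<cdot>\<^bsub>C\<^esub> action_section (X, l) = action_section (X', l') \<cdot>\<^bsub>C\<^esub> f"
proof -
  let ?T = "farr (mfun M)"
  have [simp]: "X \<in> Obj C" "X' \<in> Obj C" "f \<in> Arr C" "Dom C f = X" "Cod C f = X'"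
    "l \<in> Arr C" "Dom C l = fobj (mfun M) X" "Cod C l = X"
    "l' \<in> Arr C" "Dom C l' = fobj (mfun M) X'" "Cod C l' = X'"
    using assms by (auto simp: is_module_def hom_def)
  have "?T f \<cdot>\<^bsub>C\<^esub> action_section (X, l) = ?T (f \<cdot>\<^bsub>C\<^esub> l) \<cdot>\<^bsub>C\<^esub> \<sigma> X \<cdot>\<^bsub>C\<^esub> munit M X"
    by (simp add: action_section_def)
  also have "\<dots> = ?T l' \<cdot>\<^bsub>C\<^esub> (?T (?T f) \<cdot>\<^bsub>C\<^esub> \<sigma> X) \<cdot>\<^bsub>C\<^esub> munit M X"
    unfolding hom by simp
  also have "?T (?T f) \<cdot>\<^bsub>C\<^esub> \<sigma> X = \<sigma> X' \<cdot>\<^bsub>C\<^esub> ?T f"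
    using \<sigma>.naturality[OF f] by simp
  also have "?T l' \<cdot>\<^bsub>C\<^esub> (\<sigma> X' \<cdot>\<^bsub>C\<^esub> ?T f) \<cdot>\<^bsub>C\<^esub> munit M X = ?T l' \<cdot>\<^bsub>C\<^esub> \<sigma> X' \<cdot>\<^bsub>C\<^esub> (?T f \<cdot>\<^bsub>C\<^esub> munit M X)"
    by simp
  also have "?T f \<cdot>\<^bsub>C\<^esub> munit M X = munit M X' \<cdot>\<^bsub>C\<^esub> f"
    using unit.naturality[OF f] by simp
  finally show ?thesis by (simp add: action_section_def)
qed

end

section \<open>Separability of the right adjoint as a section of the counit\<close>

locale split_counit = adjunction +
  fixes \<nu>
  assumes section_nat_trans: "nat_trans D D id_functor (F \<odot> G) \<nu>"
    and counit_section: "Y \<in> Obj D \<Longrightarrow> \<epsilon> Y \<cdot>\<^bsub>D\<^esub> \<nu> Y = Ide D Y"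
begin

sublocale splitting: nat_trans D D id_functor "F \<odot> G" \<nu>
  by (rule section_nat_trans)

lemma section_natural:
  assumes "f \<in> Arr D" "Dom D f = X" "Cod D f = Y"
  shows "farr F (farr G f) \<cdot>\<^bsub>D\<^esub> \<nu> X = \<nu> Y \<cdot>\<^bsub>D\<^esub> f"
  using splitting.naturality_arr[OF assms] by simp

lemma section_image_natural:
  assumes "f \<in> Arr D" "Dom D f = X" "Cod D f = Y"
  shows "farr G (farr F (farr G f)) \<cdot>\<^bsub>C\<^esub> farr G (\<nu> X) = farr G (\<nu> Y) \<cdot>\<^bsub>C\<^esub> farr G f"
  using section_natural[OF assms] assms by (auto simp flip: G.map_comp_arr)

lemma counit_section_image:
  "Y \<in> Obj D \<Longrightarrow> farr G (\<epsilon> Y) \<cdot>\<^bsub>C\<^esub> farr G (\<nu> Y) = Ide C (fobj G Y)"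
  using counit_section[of Y] by (simp flip: G.map_comp_arr)

text \<open>For \<open>k = G f\<close>, naturality of \<open>\<nu>\<close> moves \<open>f\<close> to the right of \<open>\<nu>\<close>, where \<open>\<epsilon>\<close> and \<open>\<nu>\<close>
  cancel; so this is the retraction of \<open>G\<close> on hom-sets.\<close>

definition transpose_retraction where
  "transpose_retraction X Y k = \<epsilon> Y \<cdot>\<^bsub>D\<^esub> farr F k \<cdot>\<^bsub>D\<^esub> \<nu> X"

lemma transpose_retraction_hom:
  assumes "X \<in> Obj D" "Y \<in> Obj D" "k \<in> hom C (fobj G X) (fobj G Y)"
  shows "transpose_retraction X Y k \<in> hom D X Y"
  using assms by (simp add: hom_def transpose_retraction_def)

lemma transpose_retraction_image:
  assumes "f \<in> hom D X Y"
  shows "transpose_retraction X Y (farr G f) = f"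
  using assms by (auto simp: hom_def transpose_retraction_def section_natural counit_section
      F.B.comp_rewrite[OF counit_section])

lemma transpose_retraction_natural:
  assumes "a \<in> hom D X' X" "b \<in> hom D Y Y'" "k \<in> hom C (fobj G X) (fobj G Y)"
  shows "transpose_retraction X' Y' (farr G b \<cdot>\<^bsub>C\<^esub> k \<cdot>\<^bsub>C\<^esub> farr G a) =
    b \<cdot>\<^bsub>D\<^esub> transpose_retraction X Y k \<cdot>\<^bsub>D\<^esub> a"
  using assms by (auto simp: hom_def transpose_retraction_def section_natural
      F.B.comp_rewrite[OF counit_natural])

lemma separable_right_adjoint: "separable_functor D C G"
  unfolding separable_functor_def
  using G.cat_functor_axioms transpose_retraction_hom transpose_retraction_image
    transpose_retraction_natural
  by (intro conjI exI[of _ transpose_retraction]) blast+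

lemma separable_adj_monad: "separable_monad C M"
  unfolding separable_monad_def
proof (intro conjI exI ballI)
  show "monad C M" by (rule monad_adj_monad)
  show "nat_trans C C (mfun M) (mfun M \<odot> mfun M) (\<lambda>X. farr G (\<nu> (fobj F X)))"
  proof (intro nat_trans.intro nat_trans_axioms.intro)
    show "cat_functor C C (mfun M)" "cat_functor C C (mfun M \<odot> mfun M)"
      by (rule monad.T.cat_functor_axioms monad.mult.F.cat_functor_axioms)+
  qed (auto simp: hom_def section_image_natural)
  fix X assume X: "X \<in> Obj C"
  show "mmult M X \<cdot>\<^bsub>C\<^esub> farr G (\<nu> (fobj F X)) = Ide C (fobj (mfun M) X)"
    using X by (simp add: counit_section_image)
  show "farr (mfun M) (mmult M X) \<cdot>\<^bsub>C\<^esub> farr G (\<nu> (fobj F (fobj (mfun M) X))) =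
      farr G (\<nu> (fobj F X)) \<cdot>\<^bsub>C\<^esub> mmult M X"
    using X by (simp add: section_image_natural)
  show "farr G (\<nu> (fobj F X)) \<cdot>\<^bsub>C\<^esub> mmult M X =
      mmult M (fobj (mfun M) X) \<cdot>\<^bsub>C\<^esub> farr (mfun M) (farr G (\<nu> (fobj F X)))"
    using X by (simp add: counit_image_natural)
qed

lemma comparison_faithful: "faithful D (Mod C M) K"
  unfolding faithful_def
proof (intro ballI impI)
  fix X Y f f' assume f: "f \<in> hom D X Y" "f' \<in> hom D X Y" and eq: "farr K f = farr K f'"
  from eq have "farr G f = farr G f'"
    using f by simp
  then show "f = f'"
    using f[THEN transpose_retraction_image] by metis
qed

text \<open>The equation of a morphism of modules \<open>k : K X \<rightarrow> K Y\<close> exchanges \<open>G \<epsilon>\<^sub>Y \<circ> G F k\<close> for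
  \<open>k \<circ> G \<epsilon>\<^sub>X\<close>, after which \<open>G \<epsilon>\<^sub>X\<close> cancels against \<open>G \<nu>\<^sub>X\<close>. So the retraction of \<open>k\<close> is a
  preimage of \<open>k\<close>.\<close>

lemma comparison_full: "full D (Mod C M) K"
  unfolding full_def
proof (intro ballI)
  fix X Y g assume X: "X \<in> Obj D" and Y: "Y \<in> Obj D"
    and "g \<in> hom (Mod C M) (fobj K X) (fobj K Y)"
  then obtain k where g: "g = (fobj K X, k, fobj K Y)" and k: "k \<in> hom C (fobj G X) (fobj G Y)"
    and hom: "k \<cdot>\<^bsub>C\<^esub> farr G (\<epsilon> X) = farr G (\<epsilon> Y) \<cdot>\<^bsub>C\<^esub> farr G (farr F k)"
    by (auto simp: hom_Mod)
  let ?f = "transpose_retraction X Y k"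
  have f: "?f \<in> hom D X Y" using transpose_retraction_hom[OF X Y k] .
  have "farr G ?f = (farr G (\<epsilon> Y) \<cdot>\<^bsub>C\<^esub> farr G (farr F k)) \<cdot>\<^bsub>C\<^esub> farr G (\<nu> X)"
    using X Y k by (simp add: transpose_retraction_def hom_def)
  also have "\<dots> = k \<cdot>\<^bsub>C\<^esub> farr G (\<epsilon> X) \<cdot>\<^bsub>C\<^esub> farr G (\<nu> X)"
    unfolding hom[symmetric] using X Y k by (simp add: hom_def)
  also have "\<dots> = k"
    using X k by (simp add: hom_def counit_section_image)
  finally have "farr K ?f = g" using comparison_simps(2)[OF f] g by simp
  with f show "\<exists>f \<in> hom D X Y. farr K f = g" by blast
qed

text \<open>The action of a module \<open>(X, l)\<close> is the coequalizer of \<open>G F l\<close> and \<open>G \<epsilon>\<close>, so a preimage under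
  \<open>K\<close> should be a coequalizer of \<open>F l\<close> and \<open>\<epsilon>\<close> in \<open>D\<close>. The section \<open>\<nu>\<close> provides an idempotent \<open>e\<close> of \<open>F X\<close> that
  coequalizes these two arrows, and \<open>u\<close> from a splitting \<open>e = v \<circ> u\<close> is the coequalizer. The
  isomorphism is \<open>l \<circ> G v\<close> with inverse \<open>G u \<circ> \<eta>\<close>.\<close>

lemma comparison_essentially_surjective:
  assumes "idempotent_complete D"
  shows "essentially_surjective D (Mod C M) K"
  unfolding essentially_surjective_def
proof (intro ballI)
  fix P assume "P \<in> Obj (Mod C M)"
  then obtain X l where P: "P = (X, l)" and module: "is_module C M (X, l)"
    by (cases P) simp
  have l [simp]: "X \<in> Obj C" "l \<in> Arr C" "Dom C l = fobj G (fobj F X)" "Cod C l = X"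
    and l_assoc: "l \<cdot>\<^bsub>C\<^esub> farr G (farr F l) = l \<cdot>\<^bsub>C\<^esub> farr G (\<epsilon> (fobj F X))"
    and l_unit: "l \<cdot>\<^bsub>C\<^esub> \<eta> X = Ide C X"
    using module by (auto simp: is_module_def hom_def)
  define e where "e = farr F l \<cdot>\<^bsub>D\<^esub> \<nu> (fobj F X)"
  have e [simp]: "e \<in> Arr D" "Dom D e = fobj F X" "Cod D e = fobj F X"
    by (simp_all add: e_def)
  have e_coequalizes: "e \<cdot>\<^bsub>D\<^esub> farr F l = e \<cdot>\<^bsub>D\<^esub> \<epsilon> (fobj F X)"
  proof -
    have "e \<cdot>\<^bsub>D\<^esub> farr F l = farr F l \<cdot>\<^bsub>D\<^esub> (\<nu> (fobj F X) \<cdot>\<^bsub>D\<^esub> farr F l)"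
      by (simp add: e_def)
    also have "\<dots> = farr F (l \<cdot>\<^bsub>C\<^esub> farr G (farr F l)) \<cdot>\<^bsub>D\<^esub> \<nu> (fobj F (fobj G (fobj F X)))"
      by (simp flip: section_natural)
    also have "\<dots> = farr F l \<cdot>\<^bsub>D\<^esub> (farr F (farr G (\<epsilon> (fobj F X))) \<cdot>\<^bsub>D\<^esub> \<nu> (fobj F (fobj G (fobj F X))))"
      unfolding l_assoc by simp
    also have "\<dots> = e \<cdot>\<^bsub>D\<^esub> \<epsilon> (fobj F X)"
      by (simp add: section_natural e_def)
    finally show ?thesis .
  qed
  \<comment> \<open>Precomposing the coequalizing property of \<open>e\<close> with \<open>\<nu>\<close> makes \<open>e\<close> idempotent.\<close>
  have "e \<cdot>\<^bsub>D\<^esub> e = (e \<cdot>\<^bsub>D\<^esub> farr F l) \<cdot>\<^bsub>D\<^esub> \<nu> (fobj F X)"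
    by (subst (2) e_def) simp
  also have "\<dots> = e"
    unfolding e_coequalizes by (simp add: counit_section)
  finally have "e \<cdot>\<^bsub>D\<^esub> e = e" .
  then obtain Y u v where [simp]: "Y \<in> Obj D"
    and uv: "u \<in> hom D (fobj F X) Y" "v \<in> hom D Y (fobj F X)"
    and e_vu: "e = v \<cdot>\<^bsub>D\<^esub> u" and u_v: "u \<cdot>\<^bsub>D\<^esub> v = Ide D Y"
    using assms e unfolding idempotent_complete_def hom_def by fastforce
  then have [simp]: "u \<in> Arr D" "Dom D u = fobj F X" "Cod D u = Y"
    "v \<in> Arr D" "Dom D v = Y" "Cod D v = fobj F X"
    by (auto simp: hom_def)
  have u_e: "u = u \<cdot>\<^bsub>D\<^esub> e"
    unfolding e_vu using F.B.comp_rewrite[OF u_v, of u] by simp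
  have u_coequalizes: "u \<cdot>\<^bsub>D\<^esub> farr F l = u \<cdot>\<^bsub>D\<^esub> \<epsilon> (fobj F X)"
  proof -
    have "u \<cdot>\<^bsub>D\<^esub> farr F l = u \<cdot>\<^bsub>D\<^esub> (e \<cdot>\<^bsub>D\<^esub> farr F l)" by (subst u_e) simp
    also have "\<dots> = (u \<cdot>\<^bsub>D\<^esub> e) \<cdot>\<^bsub>D\<^esub> \<epsilon> (fobj F X)" unfolding e_coequalizes by simp
    also have "\<dots> = u \<cdot>\<^bsub>D\<^esub> \<epsilon> (fobj F X)" using u_e by simp
    finally show ?thesis .
  qed
  have l_e: "l \<cdot>\<^bsub>C\<^esub> farr G e = l"
  proof -
    have "l \<cdot>\<^bsub>C\<^esub> farr G e = (l \<cdot>\<^bsub>C\<^esub> farr G (farr F l)) \<cdot>\<^bsub>C\<^esub> farr G (\<nu> (fobj F X))"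
      by (simp add: e_def)
    also have "\<dots> = l"
      unfolding l_assoc by (simp add: counit_section_image)
    finally show ?thesis .
  qed
  define w where "w = l \<cdot>\<^bsub>C\<^esub> farr G v"
  define z where "z = farr G u \<cdot>\<^bsub>C\<^esub> \<eta> X"
  have wz: "w \<in> hom C (fobj G Y) X" "z \<in> hom C X (fobj G Y)"
    by (simp_all add: w_def z_def hom_def)
  have w_z: "w \<cdot>\<^bsub>C\<^esub> z = Ide C X"
  proof -
    have "w \<cdot>\<^bsub>C\<^esub> z = (l \<cdot>\<^bsub>C\<^esub> farr G e) \<cdot>\<^bsub>C\<^esub> \<eta> X"
      by (simp add: w_def z_def e_vu)
    also have "\<dots> = Ide C X" unfolding l_e by (rule l_unit)
    finally show ?thesis .
  qed
  have z_w: "z \<cdot>\<^bsub>C\<^esub> w = Ide C (fobj G Y)"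
  proof -
    have "z \<cdot>\<^bsub>C\<^esub> w = farr G u \<cdot>\<^bsub>C\<^esub> (\<eta> X \<cdot>\<^bsub>C\<^esub> l) \<cdot>\<^bsub>C\<^esub> farr G v"
      by (simp add: w_def z_def)
    also have "\<eta> X \<cdot>\<^bsub>C\<^esub> l = farr G (farr F l) \<cdot>\<^bsub>C\<^esub> \<eta> (fobj G (fobj F X))"
      using unit.naturality_arr[of l] by simp
    also have "farr G u \<cdot>\<^bsub>C\<^esub> (farr G (farr F l) \<cdot>\<^bsub>C\<^esub> \<eta> (fobj G (fobj F X))) \<cdot>\<^bsub>C\<^esub> farr G v =
        farr G (u \<cdot>\<^bsub>D\<^esub> farr F l) \<cdot>\<^bsub>C\<^esub> \<eta> (fobj G (fobj F X)) \<cdot>\<^bsub>C\<^esub> farr G v"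
      by simp
    also have "\<dots> = farr G u \<cdot>\<^bsub>C\<^esub>
        (farr G (\<epsilon> (fobj F X)) \<cdot>\<^bsub>C\<^esub> \<eta> (fobj G (fobj F X))) \<cdot>\<^bsub>C\<^esub> farr G v"
      unfolding u_coequalizes by simp
    also have "\<dots> = farr G (u \<cdot>\<^bsub>D\<^esub> v)"
      by (simp add: triangle_G)
    finally show ?thesis by (simp add: u_v)
  qed
  have "w \<cdot>\<^bsub>C\<^esub> farr G (\<epsilon> Y) = l \<cdot>\<^bsub>C\<^esub> farr (mfun M) w"
  proof -
    have "w \<cdot>\<^bsub>C\<^esub> farr G (\<epsilon> Y) =
        (l \<cdot>\<^bsub>C\<^esub> farr G (\<epsilon> (fobj F X))) \<cdot>\<^bsub>C\<^esub> farr G (farr F (farr G v))"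
      by (simp add: w_def counit_image_natural)
    also have "\<dots> = l \<cdot>\<^bsub>C\<^esub> farr (mfun M) w"
      unfolding l_assoc[symmetric] by (simp add: w_def)
    finally show ?thesis .
  qed
  then have "is_iso (Mod C M) (fobj K Y) P (fobj K Y, w, P)"
    unfolding P using monad.is_iso_Mod[OF _ module wz z_w w_z]
    by (simp add: comparison_module)
  then show "\<exists>Y \<in> Obj D. \<exists>b. is_iso (Mod C M) (fobj K Y) P b"
    using \<open>Y \<in> Obj D\<close> by blast
qed

end

context adjunction
begin

text \<open>The retraction \<open>H\<close> is applied to the unit at \<open>G Y\<close>. Naturality of \<open>H\<close> reduces every composite
  with \<open>\<nu>\<close> to a composite with \<open>\<eta>\<close> under \<open>H\<close>, so naturality of \<open>\<nu>\<close> follows from that of \<open>\<eta>\<close> and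
  the section property from the triangle identity.\<close>

lemma split_counit_if_separable:
  assumes "separable_functor D C G"
  shows "\<exists>\<nu>. split_counit C D F G \<eta> \<epsilon> \<nu>"
proof -
  from assms obtain H where
    H_hom: "\<And>X Y k. X \<in> Obj D \<Longrightarrow> Y \<in> Obj D \<Longrightarrow> k \<in> hom C (fobj G X) (fobj G Y)
      \<Longrightarrow> H X Y k \<in> hom D X Y"
    and H_nat: "\<And>X Y X' Y' a b k. X \<in> Obj D \<Longrightarrow> Y \<in> Obj D \<Longrightarrow> X' \<in> Obj D \<Longrightarrow> Y' \<in> Obj D
      \<Longrightarrow> a \<in> hom D X' X \<Longrightarrow> b \<in> hom D Y Y' \<Longrightarrow> k \<in> hom C (fobj G X) (fobj G Y)
      \<Longrightarrow> H X' Y' (farr G b \<cdot>\<^bsub>C\<^esub> k \<cdot>\<^bsub>C\<^esub> farr G a) = b \<cdot>\<^bsub>D\<^esub> H X Y k \<cdot>\<^bsub>D\<^esub> a"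
    and H_id: "\<And>X Y f. X \<in> Obj D \<Longrightarrow> Y \<in> Obj D \<Longrightarrow> f \<in> hom D X Y \<Longrightarrow> H X Y (farr G f) = f"
    unfolding separable_functor_def by (elim conjE exE) (rule that, blast+)
  define \<nu> where "\<nu> Y = H Y (fobj F (fobj G Y)) (\<eta> (fobj G Y))" for Y
  have \<nu>: "\<nu> Y \<in> hom D Y (fobj F (fobj G Y))" if "Y \<in> Obj D" for Y
    unfolding \<nu>_def by (rule H_hom) (use that in \<open>simp_all add: hom_def\<close>)
  \<comment> \<open>Naturality of \<open>H\<close> in one variable at a time, with an identity in the other.\<close>
  have post: "b \<cdot>\<^bsub>D\<^esub> \<nu> Y = H Y Z (farr G b \<cdot>\<^bsub>C\<^esub> \<eta> (fobj G Y))"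
    if Y: "Y \<in> Obj D" and b: "b \<in> hom D (fobj F (fobj G Y)) Z" for Y Z b
  proof -
    have "Z \<in> Obj D" using b by (auto simp: hom_def)
    then show ?thesis
      using H_nat[of Y "fobj F (fobj G Y)" Y Z "Ide D Y" b "\<eta> (fobj G Y)"] Y b \<nu>[OF Y]
      by (simp add: \<nu>_def hom_def)
  qed
  have pre: "\<nu> Y \<cdot>\<^bsub>D\<^esub> a = H X (fobj F (fobj G Y)) (\<eta> (fobj G Y) \<cdot>\<^bsub>C\<^esub> farr G a)"
    if a: "a \<in> hom D X Y" for X Y a
  proof -
    have XY: "X \<in> Obj D" "Y \<in> Obj D" using a by (auto simp: hom_def)
    then show ?thesis
      using H_nat[of Y "fobj F (fobj G Y)" X "fobj F (fobj G Y)" a "Ide D (fobj F (fobj G Y))"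
          "\<eta> (fobj G Y)"] a \<nu>[OF XY(2)]
      by (simp add: \<nu>_def hom_def)
  qed
  have "split_counit C D F G \<eta> \<epsilon> \<nu>"
  proof (intro split_counit.intro split_counit_axioms.intro nat_trans.intro nat_trans_axioms.intro)
    show "adjunction C D F G \<eta> \<epsilon>" by (rule adjunction_axioms)
    show "cat_functor D D id_functor" "cat_functor D D (F \<odot> G)"
      by (rule counit.F.cat_functor_axioms counit.G.cat_functor_axioms)+
    show "\<nu> Y \<in> hom D (fobj id_functor Y) (fobj (F \<odot> G) Y)" if "Y \<in> Obj D" for Y
      using \<nu>[OF that] by simp
    show "farr (F \<odot> G) f \<cdot>\<^bsub>D\<^esub> \<nu> X = \<nu> Y \<cdot>\<^bsub>D\<^esub> farr id_functor f" if f: "f \<in> hom D X Y" for f X Y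
    proof -
      have X: "X \<in> Obj D" using f by (auto simp: hom_def)
      have "farr G (farr F (farr G f)) \<cdot>\<^bsub>C\<^esub> \<eta> (fobj G X) = \<eta> (fobj G Y) \<cdot>\<^bsub>C\<^esub> farr G f"
        using unit.naturality[OF G.map_hom[OF f]] by simp
      then show ?thesis
        using post[OF X F.map_hom[OF G.map_hom[OF f]]] pre[OF f] by simp
    qed
    show "\<epsilon> Y \<cdot>\<^bsub>D\<^esub> \<nu> Y = Ide D Y" if Y: "Y \<in> Obj D" for Y
      using post[OF Y, of "\<epsilon> Y" Y] H_id[OF Y Y F.B.ide_hom[OF Y]] Y
      by (simp add: hom_def triangle_G)
  qed
  then show ?thesis by blast
qed

text \<open>The section of the action of \<open>K Y\<close> is a morphism \<open>K Y \<rightarrow> K (F G Y)\<close>, so fullness provides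
  \<open>\<nu> Y\<close> above it; the equations for \<open>\<nu>\<close> hold after applying \<open>G\<close>, which is faithful along with \<open>K\<close>.\<close>

lemma split_counit_if_comparison_fully_faithful:
  assumes sep: "separable_monad C M"
    and faithful: "faithful D (Mod C M) K" and full: "full D (Mod C M) K"
  shows "\<exists>\<nu>. split_counit C D F G \<eta> \<epsilon> \<nu>"
proof -
  from sep obtain \<sigma> where "split_monad C M \<sigma>"
    unfolding separable_monad_def split_monad_def split_monad_axioms_def by blast
  then interpret \<sigma>: split_monad C M \<sigma> .
  note splits = \<sigma>.action_section_splits[OF comparison_module]
  note natural = \<sigma>.action_section_natural[OF comparison_module comparison_module]
  define s where "s Y = \<sigma>.action_section (fobj K Y)" for Y
  have "\<exists>n. n \<in> hom D Y (fobj F (fobj G Y)) \<and> farr G n = s Y" if Y: "Y \<in> Obj D" for Y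
  proof -
    have FGY: "fobj F (fobj G Y) \<in> Obj D" using Y by simp
    have "(fobj K Y, s Y, fobj K (fobj F (fobj G Y)))
        \<in> hom (Mod C M) (fobj K Y) (fobj K (fobj F (fobj G Y)))"
      using splits[OF Y] comparison_module[OF Y] comparison_module[OF FGY]
      by (simp add: hom_Mod s_def)
    then obtain n where n: "n \<in> hom D Y (fobj F (fobj G Y))"
      and "farr K n = (fobj K Y, s Y, fobj K (fobj F (fobj G Y)))"
      using full Y FGY unfolding full_def by blast
    then show ?thesis using comparison_simps(2)[OF n] by auto
  qed
  then obtain \<nu> where \<nu>: "\<And>Y. Y \<in> Obj D \<Longrightarrow> \<nu> Y \<in> hom D Y (fobj F (fobj G Y))"
    and G_\<nu>: "\<And>Y. Y \<in> Obj D \<Longrightarrow> farr G (\<nu> Y) = s Y"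
    by metis
  have unique: "f = f'" if f: "f \<in> hom D X Y" "f' \<in> hom D X Y" and "farr G f = farr G f'" for f f' X Y
    using that comparison_simps(2)[OF f(1)] comparison_simps(2)[OF f(2)]
    by (intro faithfulD[OF faithful F.B.category_axioms]) (auto simp: hom_def)
  have "split_counit C D F G \<eta> \<epsilon> \<nu>"
  proof (intro split_counit.intro split_counit_axioms.intro nat_trans.intro nat_trans_axioms.intro)
    show "adjunction C D F G \<eta> \<epsilon>" by (rule adjunction_axioms)
    show "cat_functor D D id_functor" "cat_functor D D (F \<odot> G)"
      by (rule counit.F.cat_functor_axioms counit.G.cat_functor_axioms)+
    show "\<nu> Y \<in> hom D (fobj id_functor Y) (fobj (F \<odot> G) Y)" if "Y \<in> Obj D" for Y
      using \<nu>[OF that] by simp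
    show "farr (F \<odot> G) f \<cdot>\<^bsub>D\<^esub> \<nu> X = \<nu> Y \<cdot>\<^bsub>D\<^esub> farr id_functor f" if f: "f \<in> hom D X Y" for f X Y
    proof (rule unique)
      have XY: "X \<in> Obj D" "Y \<in> Obj D" using f by (auto simp: hom_def)
      show "farr (F \<odot> G) f \<cdot>\<^bsub>D\<^esub> \<nu> X \<in> hom D X (fobj F (fobj G Y))"
        "\<nu> Y \<cdot>\<^bsub>D\<^esub> farr id_functor f \<in> hom D X (fobj F (fobj G Y))"
        using f \<nu>[OF XY(1)] \<nu>[OF XY(2)] by (auto simp: hom_def)
      show "farr G (farr (F \<odot> G) f \<cdot>\<^bsub>D\<^esub> \<nu> X) = farr G (\<nu> Y \<cdot>\<^bsub>D\<^esub> farr id_functor f)"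
        using f \<nu>[OF XY(1)] \<nu>[OF XY(2)] G_\<nu>[OF XY(1)] G_\<nu>[OF XY(2)]
          natural[OF XY G.map_hom[OF f]]
        by (auto simp: hom_def s_def counit_image_natural)
    qed
    show "\<epsilon> Y \<cdot>\<^bsub>D\<^esub> \<nu> Y = Ide D Y" if Y: "Y \<in> Obj D" for Y
    proof (rule unique)
      show "\<epsilon> Y \<cdot>\<^bsub>D\<^esub> \<nu> Y \<in> hom D Y Y" "Ide D Y \<in> hom D Y Y"
        using Y \<nu>[OF Y] by (auto simp: hom_def)
      show "farr G (\<epsilon> Y \<cdot>\<^bsub>D\<^esub> \<nu> Y) = farr G (Ide D Y)"
        using Y \<nu>[OF Y] splits(2)[OF Y] by (simp add: hom_def G_\<nu> s_def)
    qed
  qed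
  then show ?thesis by blast
qed

end

theorem corollary3p6:
  fixes C :: "('o1, 'm1) category" and D :: "('o2, 'm2) category"
    and F :: "('o1, 'm1, 'o2, 'm2) cat_functor" and G :: "('o2, 'm2, 'o1, 'm1) cat_functor"
    and \<eta> :: "'o1 \<Rightarrow> 'm1" and \<epsilon> :: "'o2 \<Rightarrow> 'm2"
  assumes "adjunction C D F G \<eta> \<epsilon>"
    and "idempotent_complete D"
  shows "separable_functor D C G \<longleftrightarrow>
    separable_monad C (adj_monad F G \<eta> \<epsilon>) \<and>
    equivalence_of_categories D (Mod C (adj_monad F G \<eta> \<epsilon>)) (comparison_functor D G \<epsilon>)"
proof
  interpret adjunction C D F G \<eta> \<epsilon> by fact
  {
    assume "separable_functor D C G"
    then obtain \<nu> where "split_counit C D F G \<eta> \<epsilon> \<nu>"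
      using split_counit_if_separable by blast
    then interpret split_counit C D F G \<eta> \<epsilon> \<nu> .
    show "separable_monad C M \<and> equivalence_of_categories D (Mod C M) K"
      using separable_adj_monad cat_functor_comparison comparison_faithful comparison_full
        comparison_essentially_surjective[OF assms(2)]
      by (blast intro: equivalence_if_fully_faithful)
  next
    assume "separable_monad C M \<and> equivalence_of_categories D (Mod C M) K"
    then obtain \<nu> where "split_counit C D F G \<eta> \<epsilon> \<nu>"
      using split_counit_if_comparison_fully_faithful equivalence_fully_faithful by blast
    then show "separable_functor D C G"
      by (rule split_counit.separable_right_adjoint)
  }
qed

end
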